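(* Let $\lambda_1,\lambda_2\in\mathbb{C}^*$ with $\lambda_1\neq-\lambda_2$. Then $M_{\lambda_1,\lambda_2}$ is a connected quandle. If moreover $\lambda_1\neq\pm\lambda_2$, then $M_{\lambda_1,\lambda_2}$ is a $2$-connected quandle.
   Context: A quandle is a non-empty set $Q$ with a binary operation $*$ such that: (Q1) $x*x=x$ for all $x$; (Q2) for all $x,y\in Q$ there is a unique $z\in Q$ with $x=z*y$; (Q3) $(x*y)*z=(x*z)*(y*z)$ for all $x,y,z$. For $y\in Q$, $R_y(x)=x*y$ is an automorphism of $Q$; $\operatorname{Inn}(Q)$ is the group generated by all $R_y$, and $Q$ is connected if $\operatorname{Inn}(Q)$ acts transitively on $Q$. Products without parentheses are left-associated. $Q$ is $1$-connected if $L_x:Q\to Q$, $L_x(y)=x*y$, is surjective for each $x\in Q$. $Q$ is $2$-connected if it is not $1$-connected and for any $x,y\in Q$ there are $1\le l,l'\le 2$ and $z_i,z'_j\in Q$ with $x=y*z_1*\cdots*z_l$ and $y=x*z'_1*\cdots*z'_{l'}$. For $\lambda_1,\lambda_2\in\mathbb{C}^*$, $M_{\lambda_1,\lambda_2}$ is the conjugacy class in $\operatorname{GL}(2,\mathbb{C})$ of the diagonal matrix $\begin{pmatrix}\lambda_1&0\\0&\lambda_2\end{pmatrix}$, regarded as a quandle with operation $X*Y=Y^{-1}XY$. *)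

theory Defs
  imports "HOL-Analysis.Analysis" "HOL-Algebra.Group_Action" "HOL-Algebra.Generated_Groups"
begin

locale quandle =
  fixes Q :: "'a set" and op :: "'a \<Rightarrow> 'a \<Rightarrow> 'a" (infixl "\<star>" 70)
  assumes nonempty: "Q \<noteq> {}"
    and closed: "\<lbrakk>x \<in> Q; y \<in> Q\<rbrakk> \<Longrightarrow> x \<star> y \<in> Q"
    and Q1: "x \<in> Q \<Longrightarrow> x \<star> x = x"
    and Q2: "\<lbrakk>x \<in> Q; y \<in> Q\<rbrakk> \<Longrightarrow> \<exists>!z. z \<in> Q \<and> x = z \<star> y"
    and Q3: "\<lbrakk>x \<in> Q; y \<in> Q; z \<in> Q\<rbrakk> \<Longrightarrow> (x \<star> y) \<star> z = (x \<star> z) \<star> (y \<star> z)"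

text \<open>Elements of \<^term>\<open>BijGroup Q\<close> are extensional functions, so the right translations are
  restricted to \<open>Q\<close>. In a quandle they are bijections of \<open>Q\<close> by \<open>Q2\<close>; hence the intersection with
  the carrier that is built into \<^const>\<open>subgroup_generated\<close> removes nothing.\<close>

definition right_translation :: "'a set \<Rightarrow> ('a \<Rightarrow> 'a \<Rightarrow> 'a) \<Rightarrow> 'a \<Rightarrow> 'a \<Rightarrow> 'a" where
  "right_translation Q op y = (\<lambda>x\<in>Q. op x y)"

definition inner_group :: "'a set \<Rightarrow> ('a \<Rightarrow> 'a \<Rightarrow> 'a) \<Rightarrow> ('a \<Rightarrow> 'a) monoid" where
  "inner_group Q op = subgroup_generated (BijGroup Q) (right_translation Q op ` Q)"

definition connected_quandle :: "'a set \<Rightarrow> ('a \<Rightarrow> 'a \<Rightarrow> 'a) \<Rightarrow> bool" where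
  "connected_quandle Q op \<longleftrightarrow> quandle Q op \<and> transitive_action (inner_group Q op) Q (\<lambda>g. g)"

definition one_connected_quandle :: "'a set \<Rightarrow> ('a \<Rightarrow> 'a \<Rightarrow> 'a) \<Rightarrow> bool" where
  "one_connected_quandle Q op \<longleftrightarrow> quandle Q op \<and> (\<forall>x\<in>Q. (\<lambda>y. op x y) ` Q = Q)"

text \<open>\<open>foldl op y [z\<^sub>1, \<dots>, z\<^sub>l]\<close> is the left-associated product of \<open>y, z\<^sub>1, \<dots>, z\<^sub>l\<close>.\<close>

definition two_connected_quandle :: "'a set \<Rightarrow> ('a \<Rightarrow> 'a \<Rightarrow> 'a) \<Rightarrow> bool" where
  "two_connected_quandle Q op \<longleftrightarrow>
     quandle Q op \<and> \<not> one_connected_quandle Q op \<and>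
     (\<forall>x\<in>Q. \<forall>y\<in>Q. \<exists>zs zs'.
        1 \<le> length zs \<and> length zs \<le> 2 \<and> set zs \<subseteq> Q \<and> x = foldl op y zs \<and>
        1 \<le> length zs' \<and> length zs' \<le> 2 \<and> set zs' \<subseteq> Q \<and> y = foldl op x zs')"

definition diag2 :: "complex \<Rightarrow> complex \<Rightarrow> complex^2^2" where
  "diag2 l1 l2 = vector [vector [l1, 0], vector [0, l2]]"

definition GL2_class :: "complex \<Rightarrow> complex \<Rightarrow> (complex^2^2) set" where
  "GL2_class l1 l2 = {matrix_inv P ** diag2 l1 l2 ** P | P. invertible P}"

definition conj_op :: "complex^2^2 \<Rightarrow> complex^2^2 \<Rightarrow> complex^2^2" where
  "conj_op X Y = matrix_inv Y ** X ** Y"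

end

theory Submission
  imports Defs
begin

text \<open>
  Write \<open>s = l1 + l2\<close> and \<open>p = l1 * l2\<close>, and let \<open>M\<close> be the conjugacy class.  For invertible \<open>Y\<close>, the
  equation \<open>X * Y = Z\<close> in \<open>M\<close> says \<open>Y Z = X Y\<close>: \<open>Y\<close> intertwines \<open>Z\<close> and \<open>X\<close>.  All identities
  are handled in this form, without inverses.

  If \<open>l1 \<noteq> l2\<close>, then \<open>M\<close> consists of all matrices of trace \<open>s\<close> and determinant \<open>p\<close>
  (\<open>GL2_class_if_trace_det\<close> and its converses).  So the question whether \<open>Z\<close> is reached from \<open>X\<close> in
  one step is whether the space of intertwiners, which is two-dimensional, contains a matrix with
  this trace and determinant.  Diagonalise \<open>P X P\<inverse> = D = R Z R\<inverse>\<close> with \<open>D = diag(l1, l2)\<close>; the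
  intertwiners are \<open>P\<inverse> diag(u, v) R\<close>.  With \<open>N = R P\<inverse>\<close> the two conditions are
  \<open>u N11 + v N22 = s\<close> and \<open>u v det N = p\<close>.  Since \<open>s\<close>, \<open>p\<close> and \<open>det N\<close> are nonzero, they can be
  solved over the complex numbers unless \<open>N11 = N22 = 0\<close>.  In that exceptional case conjugation by
  \<open>N\<close> swaps the two eigenvalues, which means \<open>X + Z = s I\<close>.  Hence one step suffices
  except when \<open>Z = s I - X\<close> (\<open>GL2_class_one_step\<close>).

  Two steps always suffice (\<open>GL2_class_two_steps\<close>): \<open>M\<close> is infinite, so it contains a \<open>W\<close> different
  from both \<open>s I - X\<close> and \<open>s I - Z\<close>, and one goes from \<open>X\<close> to \<open>W\<close> to \<open>Z\<close>.  The exceptional pair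
  really is an obstruction (\<open>GL2_class_not_one_connected\<close>): an intertwiner of \<open>diag(l2, l1)\<close> and
  \<open>diag(l1, l2)\<close> has zero diagonal, hence trace \<open>0 \<noteq> s\<close>.  Connectedness follows because
  left-associated products are values of elements of the inner group; for \<open>l1 = l2\<close> the class is a
  single scalar matrix.
\<close>

section \<open>Conjugation of matrices\<close>

lemma matrix_inv_inverse:
  assumes "invertible A"
  shows "A ** matrix_inv A = mat 1" and "matrix_inv A ** A = mat 1"
  using assms unfolding invertible_def matrix_inv_def by (metis (mono_tags, lifting) someI_ex)+

lemma invertible_matrix_inv: "invertible A \<Longrightarrow> invertible (matrix_inv A)"
  using matrix_inv_inverse unfolding invertible_def by blast

lemma invertible_mult_left_cancel:
  fixes A :: "'a::comm_ring_1^'n^'n"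
  assumes "invertible A" and "A ** B = A ** C"
  shows "B = C"
  by (metis assms matrix_inv_inverse(2) matrix_mul_assoc matrix_mul_lid)

text \<open>Together with \<open>conj_op_eqI\<close> this describes conjugation by an equation free of inverses, so that
  later arguments only move factors across products.\<close>

lemma conj_op_intertwines:
  assumes "invertible Y"
  shows "Y ** conj_op X Y = X ** Y"
  unfolding conj_op_def using matrix_inv_inverse[OF assms] by (simp add: matrix_mul_assoc)

lemma conj_op_eqI:
  assumes "invertible Y" and "Y ** Z = X ** Y"
  shows "conj_op X Y = Z"
  using invertible_mult_left_cancel[OF assms(1)] conj_op_intertwines[OF assms(1)] assms(2)
  by metis

lemma GL2_class_iff:
  "X \<in> GL2_class l1 l2 \<longleftrightarrow> (\<exists>P. invertible P \<and> P ** X = diag2 l1 l2 ** P)"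
proof -
  have "X \<in> GL2_class l1 l2 \<longleftrightarrow> (\<exists>P. invertible P \<and> conj_op (diag2 l1 l2) P = X)"
    unfolding GL2_class_def conj_op_def by auto
  then show ?thesis
    using conj_op_intertwines conj_op_eqI by blast
qed

text \<open>If \<open>P\<close> diagonalises \<open>X\<close>, then \<open>P Y\<close> diagonalises \<open>Y\<inverse> X Y\<close>.\<close>

lemma GL2_class_conj_closed:
  assumes "X \<in> GL2_class l1 l2" and "invertible Y"
  shows "conj_op X Y \<in> GL2_class l1 l2"
proof -
  obtain P where P: "invertible P" "P ** X = diag2 l1 l2 ** P"
    using assms(1) GL2_class_iff by blast
  have "(P ** Y) ** conj_op X Y = P ** (X ** Y)"
    using conj_op_intertwines[OF assms(2)] by (metis matrix_mul_assoc)
  also have "\<dots> = diag2 l1 l2 ** (P ** Y)"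
    by (metis P(2) matrix_mul_assoc)
  finally show ?thesis
    using P(1) assms(2) invertible_mult GL2_class_iff by blast
qed

section \<open>Two-by-two matrices\<close>

lemmas matrix2_simps = vec_eq_iff forall_2 matrix_matrix_mult_def sum_2 mat_def

lemma trace_2: "trace (A :: 'a::comm_semiring_1^2^2) = A$1$1 + A$2$2"
  by (simp add: trace_def sum_2)

lemma diag2_nth [simp]:
  "diag2 l1 l2 $ 1 $ 1 = l1" "diag2 l1 l2 $ 1 $ 2 = 0"
  "diag2 l1 l2 $ 2 $ 1 = 0" "diag2 l1 l2 $ 2 $ 2 = l2"
  by (simp_all add: diag2_def)

lemma det_diag2: "det (diag2 l1 l2) = l1 * l2"
  by (simp add: det_2)

lemma diag2_in_GL2_class: "diag2 l1 l2 \<in> GL2_class l1 l2"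
  unfolding GL2_class_iff by (rule exI[of _ "mat 1"]) (simp add: invertible_det_nz)

lemma GL2_class_det:
  assumes "X \<in> GL2_class l1 l2"
  shows "det X = l1 * l2"
proof -
  obtain P where P: "invertible P" "P ** X = diag2 l1 l2 ** P"
    using assms GL2_class_iff by blast
  have "det P * det X = l1 * l2 * det P"
    using arg_cong[OF P(2), of det] by (simp add: det_mul det_diag2)
  then show ?thesis
    using P(1) by (simp add: invertible_det_nz)
qed

lemma GL2_class_trace:
  assumes "X \<in> GL2_class l1 l2"
  shows "trace X = l1 + l2"
proof -
  obtain P where P: "invertible P" "X = matrix_inv P ** diag2 l1 l2 ** P"
    using assms unfolding GL2_class_def by blast
  have "trace X = trace (P ** (matrix_inv P ** diag2 l1 l2))"
    unfolding P(2) by (rule trace_mul_sym)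
  also have "\<dots> = trace (diag2 l1 l2)"
    using matrix_inv_inverse[OF P(1)] by (simp add: matrix_mul_assoc)
  finally show ?thesis
    by (simp add: trace_2)
qed

lemma GL2_class_invertible:
  assumes "l1 \<noteq> 0" "l2 \<noteq> 0" "X \<in> GL2_class l1 l2"
  shows "invertible X"
  using GL2_class_det[OF assms(3)] assms(1,2) by (simp add: invertible_det_nz)

text \<open>A diagonalising \<open>P\<close> has left eigenvectors of \<open>X\<close> for \<open>l1\<close> and \<open>l2\<close> as its rows.  By Cayley--Hamilton,
  \<open>(X - l1)(X - l2) = 0\<close>, so the rows of \<open>X - l2\<close> are candidates for the first and those of
  \<open>X - l1\<close> for the second.  The lower rows work when the lower left entry of \<open>X\<close> is
  nonzero; otherwise \<open>X\<close> is upper triangular, and the order in which \<open>l1\<close> and \<open>l2\<close> stand on its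
  diagonal matters.\<close>

lemma GL2_class_if_trace_det:
  assumes "l1 \<noteq> l2" and tr: "trace X = l1 + l2" and dt: "det X = l1 * l2"
  shows "X \<in> GL2_class l1 l2"
proof -
  let ?x = "X$1$1" and ?y = "X$1$2" and ?z = "X$2$1" and ?w = "X$2$2"
  have w: "?w = l1 + l2 - ?x"
    using tr by (simp add: trace_2 algebra_simps)
  have yz: "?y * ?z = (l1 - ?x) * (?x - l2)"
    using dt by (simp add: det_2 w algebra_simps)
  have "\<exists>P. det P \<noteq> 0 \<and> P ** X = diag2 l1 l2 ** P"
  proof (cases "?z = 0")
    case False
    \<comment> \<open>The lower row of \<open>X - l2\<close> is \<open>(z, w - l2)\<close>, and \<open>w - l2 = l1 - x\<close> by the trace condition.\<close>
    let ?P = "vector [vector [?z, l1 - ?x], vector [?z, l2 - ?x]] :: complex^2^2"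
    have "det ?P = ?z * (l2 - l1)"
      by (simp add: det_2 algebra_simps)
    then have "det ?P \<noteq> 0"
      using False assms(1) by simp
    moreover have "?P ** X = diag2 l1 l2 ** ?P"
      using yz by (simp add: matrix2_simps w algebra_simps)
    ultimately show ?thesis
      by blast
  next
    case z: True
    then consider "?x = l1" | "?x = l2"
      using yz by auto
    then show ?thesis
    proof cases
      case 1
      let ?P = "vector [vector [l1 - l2, ?y], vector [0, 1]] :: complex^2^2"
      have "det ?P \<noteq> 0"
        using assms(1) by (simp add: det_2)
      moreover have "?P ** X = diag2 l1 l2 ** ?P"
        using 1 z by (simp add: matrix2_simps w algebra_simps)
      ultimately show ?thesis
        by blast
    next
      case 2
      let ?P = "vector [vector [0, 1], vector [l2 - l1, ?y]] :: complex^2^2"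
      have "det ?P \<noteq> 0"
        using assms(1) by (simp add: det_2)
      moreover have "?P ** X = diag2 l1 l2 ** ?P"
        using 2 z by (simp add: matrix2_simps w algebra_simps)
      ultimately show ?thesis
        by blast
    qed
  qed
  then show ?thesis
    unfolding GL2_class_iff invertible_det_nz .
qed

section \<open>Conjugation as a quandle operation\<close>

lemma quandle_GL2_class:
  assumes nz: "l1 \<noteq> 0" "l2 \<noteq> 0"
  shows "quandle (GL2_class l1 l2) conj_op"
proof
  let ?M = "GL2_class l1 l2"
  note inv = GL2_class_invertible[OF nz]
  show "?M \<noteq> {}"
    using diag2_in_GL2_class by blast
  show closed: "conj_op x y \<in> ?M" if "x \<in> ?M" "y \<in> ?M" for x y
    by (rule GL2_class_conj_closed[OF that(1) inv[OF that(2)]])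
  show "conj_op x x = x" if "x \<in> ?M" for x
    by (rule conj_op_eqI[OF inv[OF that] refl])
  show "\<exists>!z. z \<in> ?M \<and> x = conj_op z y" if "x \<in> ?M" "y \<in> ?M" for x y
  proof (rule ex1I)
    have y: "invertible y" "invertible (matrix_inv y)"
      using inv[OF that(2)] invertible_matrix_inv by auto
    let ?z = "conj_op x (matrix_inv y)"
    have "y ** x = y ** (x ** matrix_inv y) ** y"
      using matrix_inv_inverse[OF y(1)] by (simp flip: matrix_mul_assoc)
    also have "\<dots> = y ** (matrix_inv y ** ?z) ** y"
      by (simp add: conj_op_intertwines[OF y(2)])
    also have "\<dots> = ?z ** y"
      using matrix_inv_inverse[OF y(1)] by (simp add: matrix_mul_assoc)
    finally have z: "y ** x = ?z ** y" .
    show "?z \<in> ?M \<and> x = conj_op ?z y"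
      using GL2_class_conj_closed[OF that(1) y(2)] conj_op_eqI[OF y(1) z] by simp
    fix z assume "z \<in> ?M \<and> x = conj_op z y"
    then have "y ** x = z ** y"
      using conj_op_intertwines[OF y(1)] by simp
    then have "z ** y ** matrix_inv y = ?z ** y ** matrix_inv y"
      using z by simp
    then show "z = ?z"
      using matrix_inv_inverse(1)[OF y(1)] by (simp flip: matrix_mul_assoc)
  qed
  show "conj_op (conj_op x y) z = conj_op (conj_op x z) (conj_op y z)"
    if xyz: "x \<in> ?M" "y \<in> ?M" "z \<in> ?M" for x y z
  proof -
    let ?u = "conj_op x z" and ?v = "conj_op x y" and ?w = "conj_op y z"
    let ?t = "conj_op ?v z"
    note y = conj_op_intertwines[OF inv[OF xyz(2)]]
    note z = conj_op_intertwines[OF inv[OF xyz(3)]]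
    \<comment> \<open>The claim amounts to \<open>w t = u w\<close>; after multiplying by \<open>z\<close> on the left both sides equal \<open>x y z\<close>.\<close>
    have "z ** (?w ** ?t) = z ** ?w ** ?t"
      by (rule matrix_mul_assoc)
    also have "\<dots> = y ** (z ** ?t)"
      unfolding z[of y] by (rule matrix_mul_assoc[symmetric])
    also have "\<dots> = x ** y ** z"
      unfolding z[of ?v] matrix_mul_assoc y[of x] ..
    also have "\<dots> = x ** (z ** ?w)"
      unfolding z[of y] by (rule matrix_mul_assoc[symmetric])
    also have "\<dots> = z ** (?u ** ?w)"
      unfolding matrix_mul_assoc z[of x] ..
    finally have "?w ** ?t = ?u ** ?w"
      by (rule invertible_mult_left_cancel[OF inv[OF xyz(3)]])
    then show ?thesis
      by (rule conj_op_eqI[OF inv[OF closed[OF xyz(2,3)]], symmetric])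
  qed
qed

section \<open>Connectedness from left-associated products\<close>

context quandle
begin

lemma right_translation_Bij:
  assumes "y \<in> Q"
  shows "right_translation Q (\<star>) y \<in> Bij Q"
proof -
  have "inj_on (\<lambda>x. x \<star> y) Q"
  proof (rule inj_onI)
    fix a b assume ab: "a \<in> Q" "b \<in> Q" "a \<star> y = b \<star> y"
    then show "a = b"
      using Q2[OF closed[OF ab(1) assms] assms] by blast
  qed
  moreover have "(\<lambda>x. x \<star> y) ` Q = Q"
  proof
    show "(\<lambda>x. x \<star> y) ` Q \<subseteq> Q"
      using closed assms by blast
    show "Q \<subseteq> (\<lambda>x. x \<star> y) ` Q"
    proof
      fix x assume "x \<in> Q"
      then show "x \<in> (\<lambda>x. x \<star> y) ` Q"
        using Q2[OF _ assms] by blast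
    qed
  qed
  ultimately have "bij_betw (\<lambda>x. x \<star> y) Q Q"
    unfolding bij_betw_def by blast
  then show ?thesis
    by (simp add: Bij_def right_translation_def)
qed

text \<open>The value is attained by the composite of the right translations by the entries of \<open>zs\<close>.\<close>

lemma inner_group_orbit_foldl:
  assumes "set zs \<subseteq> Q" and "x \<in> Q"
  shows "\<exists>g \<in> carrier (inner_group Q (\<star>)). g x = foldl (\<star>) x zs"
  using assms
proof (induction zs rule: rev_induct)
  interpret B: group "BijGroup Q" by (rule group_BijGroup)
  let ?I = "inner_group Q (\<star>)"
  interpret I: group ?I unfolding inner_group_def by simp
  case Nil
  have "\<one>\<^bsub>?I\<^esub> = (\<lambda>x\<in>Q. x)"
    by (simp add: inner_group_def BijGroup_def)
  then show ?case
    using I.one_closed Nil(2) by (intro bexI[of _ "\<one>\<^bsub>?I\<^esub>"]) simp_all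
next
  interpret B: group "BijGroup Q" by (rule group_BijGroup)
  let ?I = "inner_group Q (\<star>)"
  interpret I: group ?I unfolding inner_group_def by simp
  case (snoc y zs)
  then obtain g where g: "g \<in> carrier ?I" "g x = foldl (\<star>) x zs"
    by auto
  let ?r = "right_translation Q (\<star>) y"
  have r: "?r \<in> Bij Q"
    using right_translation_Bij snoc by simp
  have gB: "g \<in> Bij Q"
    using g(1) B.carrier_subgroup_generated_subset
    unfolding inner_group_def by (auto simp: BijGroup_def)
  have "right_translation Q (\<star>) ` Q \<subseteq> carrier (BijGroup Q)"
    using right_translation_Bij by (auto simp: BijGroup_def)
  then have "right_translation Q (\<star>) ` Q \<subseteq> carrier ?I"
    unfolding inner_group_def by (rule B.subgroup_generated_subset_carrier_subset)
  then have "?r \<in> carrier ?I"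
    using snoc(2) by auto
  then have "?r \<otimes>\<^bsub>?I\<^esub> g \<in> carrier ?I"
    using g(1) by simp
  moreover have "(?r \<otimes>\<^bsub>?I\<^esub> g) x = ?r (g x)"
    using r gB snoc(3) by (simp add: inner_group_def BijGroup_def compose_def)
  moreover have "g x \<in> Q"
    using gB snoc(3) Bij_imp_funcset by blast
  ultimately show ?case
    using g(2) by (auto simp: right_translation_def)
qed

lemma connected_quandle_if_foldl:
  assumes "\<And>x y. \<lbrakk>x \<in> Q; y \<in> Q\<rbrakk> \<Longrightarrow> \<exists>zs. set zs \<subseteq> Q \<and> y = foldl (\<star>) x zs"
  shows "connected_quandle Q (\<star>)"
proof -
  interpret B: group "BijGroup Q" by (rule group_BijGroup)
  have "(\<lambda>g. g) \<in> hom (inner_group Q (\<star>)) (BijGroup Q)"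
    unfolding inner_group_def by (rule B.hom_from_subgroup_generated) (simp add: hom_def)
  then have "group_hom (inner_group Q (\<star>)) (BijGroup Q) (\<lambda>g. g)"
    by (simp add: group_hom_def group_hom_axioms_def inner_group_def B.is_group)
  moreover have "\<exists>g \<in> carrier (inner_group Q (\<star>)). g x = y" if "x \<in> Q" "y \<in> Q" for x y
    using assms[OF that] inner_group_orbit_foldl that by metis
  ultimately have "transitive_action (inner_group Q (\<star>)) Q (\<lambda>g. g)"
    by (simp add: transitive_action_def transitive_action_axioms_def group_action_def)
  then show ?thesis
    unfolding connected_quandle_def using quandle_axioms by blast
qed

end

section \<open>Reaching one matrix from another\<close>

text \<open>\<open>u\<close> and \<open>v\<close> are the roots of \<open>T\<^sup>2 - s T + q\<close>; this is where the complex field is used.\<close>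

lemma exists_sum_product:
  fixes s q :: complex
  shows "\<exists>u v. u + v = s \<and> u * v = q"
proof (intro exI conjI)
  let ?r = "csqrt (s\<^sup>2 - 4 * q)"
  show "(s + ?r) / 2 + (s - ?r) / 2 = s"
    by (simp add: field_simps)
  have "(s + ?r) / 2 * ((s - ?r) / 2) = (s\<^sup>2 - ?r\<^sup>2) / 4"
    by (simp add: field_simps power2_eq_square)
  then show "(s + ?r) / 2 * ((s - ?r) / 2) = q"
    by simp
qed

text \<open>If both \<open>a\<close> and \<open>d\<close> are nonzero, the rescaled unknowns \<open>u a\<close> and \<open>v d\<close> have prescribed sum and
  product.  If only one is nonzero, the linear equation fixes one unknown, which is nonzero because
  \<open>s \<noteq> 0\<close>, and the product then fixes the other.\<close>

lemma exists_weights: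
  fixes a d s p m :: complex
  assumes "a \<noteq> 0 \<or> d \<noteq> 0" and "s \<noteq> 0" and "m \<noteq> 0"
  shows "\<exists>u v. u * a + v * d = s \<and> u * v * m = p"
proof -
  consider "a \<noteq> 0" "d \<noteq> 0" | "a \<noteq> 0" "d = 0" | "a = 0" "d \<noteq> 0"
    using assms(1) by blast
  then show ?thesis
  proof cases
    case 1
    obtain u v where "u + v = s" "u * v = p * a * d / m"
      using exists_sum_product by blast
    then show ?thesis
      using 1 assms(3) by (intro exI[of _ "u / a"] exI[of _ "v / d"]) (simp add: field_simps)
  next
    case 2
    then show ?thesis
      using assms(2,3) by (intro exI[of _ "s / a"] exI[of _ "p * a / (s * m)"]) simp
  next
    case 3
    then show ?thesis
      using assms(2,3) by (intro exI[of _ "p * d / (s * m)"] exI[of _ "s / d"]) simp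
  qed
qed

text \<open>The matrix \<open>mat (l1 + l2) - X\<close> is the member of the class with the same eigenlines as \<open>X\<close> and
  the eigenvalues interchanged.  The proof constructs \<open>Y\<close> as \<open>P\<inverse> diag(u, v) R\<close>, where \<open>P\<close> and \<open>R\<close>
  diagonalise \<open>X\<close> and \<open>Z\<close>; any such product intertwines, and \<open>u\<close> and \<open>v\<close> are chosen to put it into
  the class.\<close>

lemma GL2_class_one_step:
  assumes nz: "l1 \<noteq> 0" "l2 \<noteq> 0" and ne: "l1 \<noteq> l2" "l1 \<noteq> - l2"
    and X: "X \<in> GL2_class l1 l2" and Z: "Z \<in> GL2_class l1 l2"
    and XZ: "X + Z \<noteq> mat (l1 + l2)"
  shows "\<exists>Y \<in> GL2_class l1 l2. Z = conj_op X Y"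
proof -
  let ?D = "diag2 l1 l2"
  have sum_nz: "l1 + l2 \<noteq> 0"
    using ne(2) by (simp add: eq_neg_iff_add_eq_0)
  obtain P where P: "invertible P" "P ** X = ?D ** P"
    using X GL2_class_iff by blast
  obtain R where R: "invertible R" "R ** Z = ?D ** R"
    using Z GL2_class_iff by blast
  let ?N = "R ** matrix_inv P"
  have NP: "?N ** P = R"
    using matrix_inv_inverse[OF P(1)] by (simp flip: matrix_mul_assoc)
  have "invertible ?N"
    using P(1) R(1) invertible_mult invertible_matrix_inv by blast
  then have detN: "det ?N \<noteq> 0"
    by (simp add: invertible_det_nz)
  have "?N$1$1 \<noteq> 0 \<or> ?N$2$2 \<noteq> 0"
  proof (rule ccontr)
    let ?S = "mat (l1 + l2) :: complex^2^2"
    assume "\<not> ?thesis"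
    then have "?N$1$1 = 0" "?N$2$2 = 0" by auto
    \<comment> \<open>Multiplication by a matrix with zero diagonal interchanges \<open>D\<close> and \<open>s I - D = diag(l2, l1)\<close>.\<close>
    moreover have "A ** ?D = (?S - ?D) ** A" if "A$1$1 = 0" "A$2$2 = 0" for A
      using that by (simp add: matrix2_simps algebra_simps)
    ultimately have swap: "?N ** ?D = (?S - ?D) ** ?N"
      by blast
    have "R ** X = ?N ** (P ** X)"
      by (simp only: NP matrix_mul_assoc)
    also have "\<dots> = ?N ** ?D ** P"
      unfolding P(2) by (rule matrix_mul_assoc)
    also have "\<dots> = (?S - ?D) ** (?N ** P)"
      unfolding swap by (rule matrix_mul_assoc[symmetric])
    also have "\<dots> = ?S ** R - ?D ** R"
      unfolding NP by (simp add: matrix2_simps algebra_simps)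
    also have "\<dots> = R ** (?S - Z)"
      unfolding R(2)[symmetric] by (simp add: matrix2_simps algebra_simps)
    finally have "X = ?S - Z"
      by (rule invertible_mult_left_cancel[OF R(1)])
    then show False
      using XZ by simp
  qed
  then obtain u v where uv: "u * ?N$1$1 + v * ?N$2$2 = l1 + l2" "u * v * det ?N = l1 * l2"
    using exists_weights[OF _ sum_nz detN] by blast
  let ?E = "diag2 u v"
  let ?Y = "matrix_inv P ** (?E ** R)"
  have "trace ?Y = trace (?E ** ?N)"
    by (subst trace_mul_sym) (simp add: matrix_mul_assoc)
  also have "trace (?E ** A) = u * A$1$1 + v * A$2$2" for A
    by (simp add: trace_2 matrix_matrix_mult_def sum_2)
  finally have "trace ?Y = l1 + l2"
    using uv(1) by simp
  moreover have "det ?Y = l1 * l2"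
    using uv(2) by (simp add: det_mul det_diag2 mult_ac)
  ultimately have Y: "?Y \<in> GL2_class l1 l2"
    by (rule GL2_class_if_trace_det[OF ne(1)])
  have ED: "?E ** ?D = ?D ** ?E"
    by (simp add: matrix2_simps)
  have XP: "X ** matrix_inv P = matrix_inv P ** ?D"
  proof -
    have "X ** matrix_inv P = matrix_inv P ** (P ** X) ** matrix_inv P"
      using matrix_inv_inverse[OF P(1)] by (simp add: matrix_mul_assoc)
    also have "\<dots> = matrix_inv P ** ?D"
      unfolding P(2) using matrix_inv_inverse[OF P(1)] by (simp flip: matrix_mul_assoc)
    finally show ?thesis .
  qed
  have "?Y ** Z = matrix_inv P ** (?E ** (R ** Z))"
    by (simp only: matrix_mul_assoc)
  also have "\<dots> = matrix_inv P ** (?E ** ?D ** R)"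
    unfolding R(2) by (simp only: matrix_mul_assoc)
  also have "\<dots> = matrix_inv P ** ?D ** (?E ** R)"
    unfolding ED by (simp only: matrix_mul_assoc)
  also have "\<dots> = X ** ?Y"
    unfolding XP[symmetric] by (simp only: matrix_mul_assoc)
  finally have "conj_op X ?Y = Z"
    by (rule conj_op_eqI[OF GL2_class_invertible[OF nz Y]])
  then show ?thesis
    using Y by blast
qed

text \<open>The upper triangular matrices with diagonal \<open>l1, l2\<close> already form an infinite subset of the class.\<close>

lemma GL2_class_avoid_two:
  assumes "l1 \<noteq> l2"
  shows "\<exists>W \<in> GL2_class l1 l2. W \<noteq> A \<and> W \<noteq> B"
proof -
  let ?W = "\<lambda>t. vector [vector [l1, t], vector [0, l2]] :: complex^2^2"
  have W: "?W t \<in> GL2_class l1 l2" for t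
    by (rule GL2_class_if_trace_det[OF assms]) (simp_all add: trace_2 det_2)
  have "inj ?W"
    by (rule injI) (simp add: vec_eq_iff forall_2)
  moreover have "infinite (UNIV :: complex set)"
    by (simp add: infinite_UNIV_char_0)
  ultimately have "infinite (range ?W)"
    using finite_imageD by blast
  then have "\<not> range ?W \<subseteq> {A, B}"
    using finite_subset by blast
  then show ?thesis
    using W by blast
qed

text \<open>An intermediate \<open>W\<close> must avoid the exceptional partners of both ends.\<close>

lemma GL2_class_two_steps:
  assumes nz: "l1 \<noteq> 0" "l2 \<noteq> 0" and ne: "l1 \<noteq> l2" "l1 \<noteq> - l2"
    and X: "X \<in> GL2_class l1 l2" and Z: "Z \<in> GL2_class l1 l2"
  shows "\<exists>ys. 1 \<le> length ys \<and> length ys \<le> 2 \<and> set ys \<subseteq> GL2_class l1 l2 \<and> Z = foldl conj_op X ys"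
proof -
  let ?S = "mat (l1 + l2) :: complex^2^2"
  obtain W where W: "W \<in> GL2_class l1 l2" "W \<noteq> ?S - X" "W \<noteq> ?S - Z"
    using GL2_class_avoid_two[OF ne(1)] by blast
  have "X + W \<noteq> ?S" "W + Z \<noteq> ?S"
    using W(2,3) by (auto simp: algebra_simps)
  then obtain Y1 Y2 where "Y1 \<in> GL2_class l1 l2" "W = conj_op X Y1"
    "Y2 \<in> GL2_class l1 l2" "Z = conj_op W Y2"
    using GL2_class_one_step[OF nz ne X W(1)] GL2_class_one_step[OF nz ne W(1) Z] by blast
  then show ?thesis
    by (intro exI[of _ "[Y1, Y2]"]) simp
qed

text \<open>No \<open>Y\<close> in the class carries \<open>diag2 l1 l2\<close> to \<open>diag2 l2 l1\<close>: comparing diagonal entries in the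
  intertwining equation forces \<open>Y\<close> to have zero diagonal, while its trace is \<open>l1 + l2 \<noteq> 0\<close>.\<close>

lemma GL2_class_not_one_connected:
  assumes nz: "l1 \<noteq> 0" "l2 \<noteq> 0" and ne: "l1 \<noteq> l2" "l1 \<noteq> - l2"
  shows "\<not> one_connected_quandle (GL2_class l1 l2) conj_op"
proof
  let ?M = "GL2_class l1 l2"
  assume "one_connected_quandle ?M conj_op"
  then have "conj_op (diag2 l1 l2) ` ?M = ?M"
    unfolding one_connected_quandle_def using diag2_in_GL2_class by blast
  moreover have "diag2 l2 l1 \<in> ?M"
    by (rule GL2_class_if_trace_det[OF ne(1)]) (simp_all add: trace_2 det_2)
  ultimately obtain Y where Y: "Y \<in> ?M" "diag2 l2 l1 = conj_op (diag2 l1 l2) Y"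
    by blast
  have "Y ** diag2 l2 l1 = diag2 l1 l2 ** Y"
    unfolding Y(2) by (rule conj_op_intertwines[OF GL2_class_invertible[OF nz Y(1)]])
  then have "Y$1$1 * l2 = l1 * Y$1$1" "Y$2$2 * l1 = l2 * Y$2$2"
    by (simp_all add: matrix2_simps)
  then have "trace Y = 0"
    using ne(1) by (simp add: trace_2)
  then show False
    using GL2_class_trace[OF Y(1)] ne(2) by (simp add: add_eq_0_iff2)
qed

lemma GL2_class_scalar: "GL2_class l l = {diag2 l l}"
proof (intro equalityI subsetI)
  fix X assume "X \<in> GL2_class l l"
  then obtain P where P: "invertible P" "P ** X = diag2 l l ** P"
    using GL2_class_iff by blast
  have "P ** X = P ** diag2 l l"
    unfolding P(2) by (simp add: matrix2_simps)
  then have "X = diag2 l l"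
    by (rule invertible_mult_left_cancel[OF P(1)])
  then show "X \<in> {diag2 l l}"
    by simp
qed (simp add: diag2_in_GL2_class)

theorem theorem4p4:
  fixes l1 l2 :: complex
  assumes "l1 \<noteq> 0" and "l2 \<noteq> 0" and "l1 \<noteq> - l2"
  shows "connected_quandle (GL2_class l1 l2) conj_op \<and>
    (l1 \<noteq> l2 \<and> l1 \<noteq> - l2 \<longrightarrow> two_connected_quandle (GL2_class l1 l2) conj_op)"
proof -
  let ?M = "GL2_class l1 l2"
  note Q = quandle_GL2_class[OF assms(1,2)]
  have connected: "connected_quandle ?M conj_op"
  proof (rule quandle.connected_quandle_if_foldl[OF Q])
    fix X Z assume XZ: "X \<in> ?M" "Z \<in> ?M"
    show "\<exists>zs. set zs \<subseteq> ?M \<and> Z = foldl conj_op X zs"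
    proof (cases "l1 = l2")
      case True
      then have "Z = foldl conj_op X []"
        using XZ by (simp add: GL2_class_scalar)
      then show ?thesis
        by (intro exI[of _ "[]"]) simp
    next
      case False
      then show ?thesis
        using GL2_class_two_steps[OF assms(1,2) _ assms(3) XZ] by blast
    qed
  qed
  have "two_connected_quandle ?M conj_op" if ne: "l1 \<noteq> l2"
    unfolding two_connected_quandle_def
  proof (intro conjI ballI)
    note reach = GL2_class_two_steps[OF assms(1,2) ne assms(3)]
    show "quandle ?M conj_op" by (rule Q)
    show "\<not> one_connected_quandle ?M conj_op"
      by (rule GL2_class_not_one_connected[OF assms(1,2) ne assms(3)])
    fix x y assume "x \<in> ?M" "y \<in> ?M"
    then show "\<exists>zs zs'. 1 \<le> length zs \<and> length zs \<le> 2 \<and> set zs \<subseteq> ?M \<and> x = foldl conj_op y zs \<and>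
        1 \<le> length zs' \<and> length zs' \<le> 2 \<and> set zs' \<subseteq> ?M \<and> y = foldl conj_op x zs'"
      using reach[of x y] reach[of y x] by blast
  qed
  with connected show ?thesis
    by blast
qed

end
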